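(* $$1 = \sum_{j=0}^{\infty} \sum_{k=0}^{j} \binom{2j+1}{k} \frac{(-1)^{k+j}\, \operatorname{Si}(\pi(j+1-k))\,(2j)!\,(j-k+1)}{16^{j} (j!)^{2} (2j+1)(2j-k+2)}.$$
   Context: $\operatorname{Si}$ denotes the sine integral, $\operatorname{Si}(z) = \int_0^z \frac{\sin t}{t}\,dt$. The double series is an iterated sum: for each $j$ the inner sum over $k$ is finite, and the outer sum is an infinite series over $j$. *)

theory Defs
  imports "HOL-Probability.Sinc_Integral"
begin

end

theory Submission
  imports Defs
begin

text \<open>
  Put $n = j + 1$ and $m = n - k$. Since
  ${2n-1 \choose k} / (2n - k) = {2n \choose k} / (2n)$, the inner sum is a multiple of
  $\sum_{m=1}^{n} (-1)^{m+1} {2n \choose n-m}\, m \operatorname{Si}(\pi m)$.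
  Writing $\operatorname{Si}(\pi m) = \int_0^\pi \sin(mu)/u\,du$ moves the sum over $m$ under one
  integral over a fixed interval, where it is the derivative of the finite Fourier expansion of
  $\sin^{2n}(u/2)$. The $j$-th term of the series therefore equals
  \[ \int_0^\pi {2j \choose j} \frac{\sin^{2j+1}(u/2)}{4^j (2j+1)} \cdot \frac{\cos(u/2)}{u}\,du \]
  (lemma \<open>inner_sum_has_integral\<close>). The integrands are nonnegative, and by the power series of
  $\arcsin$ (lemma \<open>arcsin_sums\<close>) they add up to
  $\arcsin(\sin(u/2)) \cos(u/2) / u = \cos(u/2) / 2$, whose integral over $[0,\pi]$ is $1$.
  Nonnegativity justifies exchanging the series and the integral
  (lemma \<open>has_integral_sums_nonneg\<close>).
\<close>

section \<open>The power series of the arcsine\<close>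

text \<open>
  Identifies the coefficients of the binomial series of $(1 - x^2)^{-1/2}$: both sides satisfy the
  recursion $(n+1)\, c_{n+1} = (-1/2 - n)\, c_n$.
\<close>
lemma gbinomial_minus_one_half:
  "(- 1 / 2 :: real) gchoose n = (- 1) ^ n * real ((2 * n) choose n) / 4 ^ n"
proof (induction n)
  case 0
  show ?case by simp
next
  case (Suc n)
  have "Suc n * ((2 * Suc n) choose Suc n) = (2 * Suc n) * ((2 * n + 1) choose n)"
    using Suc_times_binomial_eq[of "2 * n + 1" n] by (simp add: algebra_simps)
  moreover have "(2 * n + 1) choose n = (2 * n + 1) choose Suc n"
    by (subst binomial_symmetric) auto
  moreover have "Suc n * ((2 * n + 1) choose Suc n) = (2 * n + 1) * ((2 * n) choose n)"
    using Suc_times_binomial_eq[of "2 * n" n] by (simp add: algebra_simps)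
  ultimately have "Suc n * ((2 * Suc n) choose Suc n) = 2 * (2 * n + 1) * ((2 * n) choose n)"
    by (metis mult.assoc mult.left_commute)
  from arg_cong[OF this, of real]
  have central: "real (Suc n) * real ((2 * Suc n) choose Suc n)
      = 2 * (2 * real n + 1) * real ((2 * n) choose n)"
    by (simp only: of_nat_mult of_nat_add of_nat_numeral of_nat_1)
  have "real (Suc n) * ((- 1 / 2) gchoose Suc n) = (- 1 / 2 - real n) * ((- 1 / 2) gchoose n)"
    by (metis gbinomial_absorb_comp gbinomial_absorption)
  also have "\<dots> = real (Suc n) * ((- 1) ^ Suc n * real ((2 * Suc n) choose Suc n) / 4 ^ Suc n)"
  proof -
    have "real (Suc n) * ((- 1) ^ Suc n * real ((2 * Suc n) choose Suc n) / 4 ^ Suc n)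
      = (- 1) ^ Suc n * (real (Suc n) * real ((2 * Suc n) choose Suc n)) / 4 ^ Suc n"
      by (simp only: mult_ac times_divide_eq_right)
    also have "\<dots> = (- 1 / 2 - real n) * ((- 1) ^ n * real ((2 * n) choose n) / 4 ^ n)"
      unfolding central by (simp add: field_simps)
    finally show ?thesis using Suc.IH by simp
  qed
  finally show ?case
    by (subst (asm) mult_left_cancel) auto
qed

lemma inverse_sqrt_one_minus_square_sums:
  fixes x :: real
  assumes "\<bar>x\<bar> < 1"
  shows "(\<lambda>n. real ((2 * n) choose n) / 4 ^ n * x ^ (2 * n)) sums (1 / sqrt (1 - x\<^sup>2))"
proof -
  have x2: "x\<^sup>2 < 1" using assms by (simp add: abs_square_less_1)
  then have "(\<lambda>n. ((- 1 / 2) gchoose n) * (- x\<^sup>2) ^ n) sums (1 + - x\<^sup>2) powr (- 1 / 2)"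
    by (intro gen_binomial_real) simp
  moreover have "((- 1 / 2) gchoose n) * (- x\<^sup>2) ^ n = real ((2 * n) choose n) / 4 ^ n * x ^ (2 * n)" for n
  proof -
    have "(- x\<^sup>2) ^ n = (- 1) ^ n * x ^ (2 * n)"
      by (simp add: power_minus[of "x\<^sup>2"] power_mult)
    moreover have "(- 1 :: real) ^ n * (- 1) ^ n = 1"
      by (simp flip: power_mult_distrib)
    ultimately show ?thesis
      unfolding gbinomial_minus_one_half by (simp add: field_simps)
  qed
  moreover have "(1 + - x\<^sup>2) powr (- 1 / 2) = 1 / sqrt (1 - x\<^sup>2)"
    using x2 powr_minus_divide[of "1 - x\<^sup>2" "1 / 2"] by (simp add: powr_half_sqrt)
  ultimately show ?thesis by simp
qed

text \<open>
  The series obtained by integrating the previous one termwise has derivative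
  $1 / \sqrt{1 - x^2}$ on $(-1,1)$ and vanishes at $0$, so it is the arcsine. In the proof the
  coefficients are spread over all powers \<open>x ^ Suc n\<close>, with zeros for odd \<open>n\<close>, which is the shape
  that termwise differentiation of power series expects.
\<close>
lemma arcsin_sums:
  fixes x :: real
  assumes "\<bar>x\<bar> < 1"
  shows "(\<lambda>n. real ((2 * n) choose n) / (4 ^ n * (2 * real n + 1)) * x ^ (2 * n + 1)) sums arcsin x"
proof -
  define b :: "nat \<Rightarrow> real" where "b n = real ((2 * n) choose n) / 4 ^ n" for n
  define f :: "nat \<Rightarrow> real" where "f n = (if even n then b (n div 2) / real (Suc n) else 0)" for n
  define F where "F x = (\<Sum>n. f n * x ^ Suc n)" for x
  have deriv_sums: "(\<lambda>n. f n * real (Suc n) * y ^ n) sums (1 / sqrt (1 - y\<^sup>2))"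
    if "\<bar>y\<bar> < 1" for y
  proof -
    have eq: "(\<lambda>n. f n * real (Suc n) * y ^ n)
        = (\<lambda>n. if even n then b (n div 2) * y ^ (2 * (n div 2)) else 0)"
      by (auto simp: f_def fun_eq_iff)
    show ?thesis
      using sums_if[OF sums_zero inverse_sqrt_one_minus_square_sums[OF that]]
      unfolding eq b_def by simp
  qed
  have f_sums: "(\<lambda>n. f n * y ^ Suc n) sums F y" if "\<bar>y\<bar> < 1" for y
  proof -
    \<comment> \<open>The series of derivatives at \<open>\<bar>y\<bar>\<close> is a majorant.\<close>
    have "summable (\<lambda>n. norm (f n * y ^ Suc n))"
    proof (rule summable_comparison_test')
      have "\<bar>\<bar>y\<bar>\<bar> < 1" using that by simp
      from deriv_sums[OF this] show "summable (\<lambda>n. f n * real (Suc n) * \<bar>y\<bar> ^ n)"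
        by (rule sums_summable)
      fix n :: nat
      have "f n \<ge> 0" by (simp add: f_def b_def)
      have "\<bar>y\<bar> ^ Suc n \<le> \<bar>y\<bar> ^ n"
        using that by (intro power_decreasing) auto
      also have "\<dots> \<le> real (Suc n) * \<bar>y\<bar> ^ n"
        by (simp add: algebra_simps)
      finally show "norm (norm (f n * y ^ Suc n)) \<le> f n * real (Suc n) * \<bar>y\<bar> ^ n"
        using \<open>f n \<ge> 0\<close> by (simp add: abs_mult power_abs mult.assoc mult_left_mono)
    qed
    then show ?thesis
      unfolding F_def by (rule summable_sums[OF summable_norm_cancel])
  qed
  have F_deriv: "(F has_real_derivative 1 / sqrt (1 - y\<^sup>2)) (at y)" if "\<bar>y\<bar> < 1" for y
  proof -
    have "((\<lambda>x. \<Sum>n. f n * x ^ Suc n) has_real_derivative (\<Sum>n. f n * real (Suc n) * y ^ n)) (at y)"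
    proof (rule DERIV_power_series'[where R = 1])
      show "summable (\<lambda>n. f n * real (Suc n) * z ^ n)" if "z \<in> {- 1<..<1}" for z
        using that by (intro sums_summable[OF deriv_sums]) auto
    qed (use that in auto)
    then show ?thesis
      using sums_unique[OF deriv_sums[OF that]] by (simp add: F_def[abs_def])
  qed
  have "((\<lambda>y. F y - arcsin y) has_real_derivative 0) (at y)" if "y \<in> {- 1<..<1}" for y
    using DERIV_diff[OF F_deriv DERIV_arcsin] that by (simp add: divide_inverse abs_less_iff)
  then have "(\<lambda>y. F y - arcsin y) constant_on {- 1<..<1}"
    by (intro has_field_derivative_0_imp_constant_on) auto
  then obtain c where c: "F y - arcsin y = c" if "y \<in> {- 1<..<1}" for y
    by (auto simp: constant_on_def)
  have "F x - arcsin x = F 0 - arcsin 0"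
    using c[of x] c[of 0] assms by (simp add: abs_less_iff)
  moreover have "F 0 = 0" by (simp add: F_def)
  ultimately have "F x = arcsin x" by simp
  then have "(\<lambda>n. f n * x ^ Suc n) sums arcsin x"
    using f_sums[OF assms] by simp
  then have "(\<lambda>n. f (2 * n) * x ^ Suc (2 * n)) sums arcsin x"
    by (subst sums_mono_reindex[where g = "\<lambda>n. 2 * n"])
       (auto simp: strict_mono_def f_def elim!: evenE)
  then show ?thesis
    by (simp add: f_def b_def algebra_simps)
qed

section \<open>The finite Fourier expansion of even powers of the sine\<close>

lemma sum_symmetric_about_middle:
  fixes g :: "nat \<Rightarrow> real"
  assumes "\<And>k. k \<le> 2 * n \<Longrightarrow> g (2 * n - k) = g k"
  shows "sum g {..2 * n} = 2 * sum g {..<n} + g n"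
proof -
  have "{..2 * n} = {..<n} \<union> ({n} \<union> {n<..2 * n})" by auto
  then have "sum g {..2 * n} = sum g {..<n} + (g n + sum g {n<..2 * n})"
    by (simp only:) (subst sum.union_disjoint; auto)+
  moreover have "sum g {n<..2 * n} = sum g {..<n}"
    by (rule sum.reindex_bij_witness[where i = "\<lambda>k. 2 * n - k" and j = "\<lambda>k. 2 * n - k"])
       (use assms in auto)
  ultimately show ?thesis by simp
qed

text \<open>
  Real part of the binomial expansion of $(e^{ix} - e^{-ix})^{2n} = (2i \sin x)^{2n}$.
\<close>
lemma sin_even_power_fourier:
  fixes x :: real
  shows "(\<Sum>k\<le>2 * n. real ((2 * n) choose k) * (- 1) ^ k * cos ((2 * real n - 2 * real k) * x))
    = (- 1) ^ n * 4 ^ n * sin x ^ (2 * n)"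
proof -
  have "cis x - cis (- x) = 2 * \<i> * complex_of_real (sin x)"
    by (simp add: complex_eq_iff)
  then have "(cis x - cis (- x))\<^sup>2 = complex_of_real (- 1 * 4 * (sin x)\<^sup>2)"
    by (simp add: power_mult_distrib)
  then have "(cis x - cis (- x)) ^ (2 * n) = complex_of_real ((- 1 * 4 * (sin x)\<^sup>2) ^ n)"
    by (simp only: power_mult of_real_power)
  then have "(cis x - cis (- x)) ^ (2 * n) = complex_of_real ((- 1) ^ n * 4 ^ n * sin x ^ (2 * n))"
    by (simp only: power_mult_distrib) (simp only: power_mult)
  moreover have "(cis x - cis (- x)) ^ (2 * n)
      = (\<Sum>k\<le>2 * n. of_nat ((2 * n) choose k) * (- cis (- x)) ^ k * cis x ^ (2 * n - k))"
    using binomial_ring[of "- cis (- x)" "cis x" "2 * n"] by simp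
  moreover have "of_nat ((2 * n) choose k) * (- cis (- x)) ^ k * cis x ^ (2 * n - k)
      = complex_of_real (real ((2 * n) choose k) * (- 1) ^ k) * cis ((2 * real n - 2 * real k) * x)"
    if "k \<le> 2 * n" for k
  proof -
    have "(- cis (- x)) ^ k * cis x ^ (2 * n - k)
        = (- 1) ^ k * cis (real k * (- x) + real (2 * n - k) * x)"
      by (simp only: power_minus[of "cis (- x)"] Complex.DeMoivre mult.assoc cis_mult)
    also have "real k * (- x) + real (2 * n - k) * x = (2 * real n - 2 * real k) * x"
      using that by (simp add: of_nat_diff algebra_simps)
    finally show ?thesis by (simp add: mult.assoc)
  qed
  ultimately have "complex_of_real ((- 1) ^ n * 4 ^ n * sin x ^ (2 * n))
      = (\<Sum>k\<le>2 * n. complex_of_real (real ((2 * n) choose k) * (- 1) ^ k)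
            * cis ((2 * real n - 2 * real k) * x))"
    by simp
  from arg_cong[OF this, of Re] show ?thesis
    by (simp add: Re_sum)
qed

text \<open>
  Differentiating the expansion of $\sin^{2n} x$ turns the cosines into the sines that the integral
  representation of \<open>Si\<close> provides. The resulting sum over \<open>k \<le> 2 * n\<close> is symmetric about the
  vanishing middle term, so each half carries half of the derivative.
\<close>
lemma sum_binomial_sin_even:
  fixes x :: real
  assumes "n > 0"
  shows "(\<Sum>k<n. real ((2 * n) choose k) * (- 1) ^ k * (real n - real k) * sin (2 * (real n - real k) * x))
    = (- 1) ^ Suc n * 4 ^ n * real n / 2 * sin x ^ (2 * n - 1) * cos x"
proof -
  define g where "g k = real ((2 * n) choose k) * (- 1) ^ k * (real n - real k)
      * sin (2 * (real n - real k) * x)" for k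
  have "((\<lambda>x. \<Sum>k\<le>2 * n. real ((2 * n) choose k) * (- 1) ^ k * cos ((2 * real n - 2 * real k) * x))
      has_real_derivative (\<Sum>k\<le>2 * n. - 2 * g k)) (at x)"
    unfolding g_def
    by (rule DERIV_sum) (auto intro!: derivative_eq_intros simp: algebra_simps)
  then have "((\<lambda>x. (- 1) ^ n * 4 ^ n * sin x ^ (2 * n)) has_real_derivative (\<Sum>k\<le>2 * n. - 2 * g k)) (at x)"
    by (simp only: sin_even_power_fourier)
  moreover have "((\<lambda>x. (- 1) ^ n * 4 ^ n * sin x ^ (2 * n)) has_real_derivative
      (- 1) ^ n * 4 ^ n * (2 * real n * sin x ^ (2 * n - 1) * cos x)) (at x)"
    by (auto intro!: derivative_eq_intros)
  ultimately have "(\<Sum>k\<le>2 * n. - 2 * g k)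
      = (- 1) ^ n * 4 ^ n * (2 * real n * sin x ^ (2 * n - 1) * cos x)"
    by (rule DERIV_unique)
  moreover have "sum g {..2 * n} = 2 * sum g {..<n}"
  proof -
    have "g (2 * n - k) = g k" if "k \<le> 2 * n" for k
    proof -
      have "(- 1 :: real) ^ (2 * n - k) = (- 1) ^ k"
        using that by (simp add: minus_one_power_iff)
      moreover have "(2 * n) choose (2 * n - k) = (2 * n) choose k"
        using that by (metis binomial_symmetric)
      moreover have "real n - real (2 * n - k) = - (real n - real k)"
        using that by (simp add: of_nat_diff)
      ultimately show ?thesis
        by (simp only: g_def mult_minus_left mult_minus_right sin_minus minus_minus)
    qed
    from sum_symmetric_about_middle[of n g, OF this] show ?thesis by (simp add: g_def)
  qed
  ultimately have "sum g {..<n} = (- 1) ^ Suc n * 4 ^ n * real n / 2 * sin x ^ (2 * n - 1) * cos x"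
    by (simp only: sum_distrib_left[symmetric]) (simp add: field_simps)
  then show ?thesis by (simp add: g_def)
qed

section \<open>Integral representation of the terms\<close>

text \<open>
  The scale \<open>c\<close> is moved from the limit of integration into the integrand, so that values of \<open>Si\<close> at
  different multiples of \<open>T\<close> become integrals over the same interval. This is the fundamental theorem
  of calculus for \<open>\<lambda>u. Si (c * u)\<close>; working in the open interval avoids the default value of
  \<open>sin (c * u) / u\<close> at \<open>0\<close>.
\<close>
lemma has_integral_Si:
  fixes c T :: real
  assumes "T \<ge> 0"
  shows "((\<lambda>u. sin (c * u) / u) has_integral Si (c * T)) {0..T}"
proof -
  have "((\<lambda>u. sin (c * u) / u) has_integral (Si (c * T) - Si (c * 0))) {0..T}"
  proof (rule fundamental_theorem_of_calculus_interior[OF assms])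
    show "continuous_on {0..T} (\<lambda>u. Si (c * u))"
      by (intro continuous_at_imp_continuous_on ballI continuous_within_compose3[OF isCont_Si])
         (auto intro!: continuous_intros)
    fix u assume "u \<in> {0<..<T}"
    have "((\<lambda>u. Si (c * u)) has_real_derivative sinc (c * u) * c) (at u)"
      by (rule DERIV_chain2[OF DERIV_Si]) (auto intro!: derivative_eq_intros)
    moreover have "sinc (c * u) * c = sin (c * u) / u"
      using \<open>u \<in> {0<..<T}\<close> by auto
    ultimately show "((\<lambda>u. Si (c * u)) has_vector_derivative sin (c * u) / u) (at u)"
      by (simp add: has_real_derivative_iff_has_vector_derivative)
  qed
  moreover have "Si 0 = 0"
    by (simp add: Si_def zero_ereal_def)
  ultimately show ?thesis by simp
qed

text \<open>
  The alternating sum of values of \<open>Si\<close> collapses to the integral of a single nonnegative function.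
  The weights \<open>w k\<close> are those of \<open>sum_binomial_sin_even\<close> for \<open>n = j + 1\<close>, evaluated at \<open>u / 2\<close>, and
  \<open>C\<close> collects the factors independent of \<open>k\<close>.
\<close>
lemma inner_sum_has_integral:
  "((\<lambda>u. real ((2 * j) choose j) / (4 ^ j * (2 * real j + 1)) * sin (u / 2) ^ (2 * j + 1) * cos (u / 2) / u)
    has_integral
     (\<Sum>k = 0..j.
            real ((2 * j + 1) choose k) *
            (((- 1) ^ (k + j) * Si (pi * (real j + 1 - real k)) * fact (2 * j) * (real j - real k + 1)) /
             (16 ^ j * (fact j)\<^sup>2 * (2 * real j + 1) * (2 * real j - real k + 2))))) {0..pi}"
proof -
  define n where "n = Suc j"
  define C where "C = (- 1) ^ j * real ((2 * j) choose j) / (16 ^ j * (2 * real j + 1) * (2 * real n))"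
  define w where "w k = real ((2 * n) choose k) * (- 1) ^ k * (real n - real k)" for k
  have "((\<lambda>u. C * (\<Sum>k<n. w k * (sin ((real n - real k) * u) / u)))
      has_integral C * (\<Sum>k<n. w k * Si ((real n - real k) * pi))) {0..pi}"
    by (intro has_integral_mult_right has_integral_sum has_integral_Si) auto
  moreover have "C * (\<Sum>k<n. w k * (sin ((real n - real k) * u) / u))
      = real ((2 * j) choose j) / (4 ^ j * (2 * real j + 1)) * sin (u / 2) ^ (2 * j + 1) * cos (u / 2) / u"
    for u
  proof -
    have "(\<Sum>k<n. w k * (sin ((real n - real k) * u) / u))
        = (\<Sum>k<n. w k * sin (2 * (real n - real k) * (u / 2))) / u"
    proof -
      have "2 * (real n - real k) * (u / 2) = (real n - real k) * u" for k by simp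
      then show ?thesis by (simp only: sum_divide_distrib times_divide_eq_right)
    qed
    also have "\<dots> = (- 1) ^ Suc n * 4 ^ n * real n / 2 * sin (u / 2) ^ (2 * n - 1) * cos (u / 2) / u"
      unfolding w_def by (subst sum_binomial_sin_even) (auto simp: n_def)
    also have "C * \<dots> = ((- 1) ^ j * (- 1) ^ Suc n) * (4 ^ n / (4 * 16 ^ j)) * (real n / real n)
        * real ((2 * j) choose j) / (2 * real j + 1) * sin (u / 2) ^ (2 * n - 1) * cos (u / 2) / u"
      by (simp add: C_def mult_ac)
    also have "(- 1 :: real) ^ j * (- 1) ^ Suc n = 1"
      by (simp add: n_def flip: power_mult_distrib)
    also have "4 ^ n / (4 * 16 ^ j :: real) = 1 / 4 ^ j"
    proof -
      have "(16 :: real) ^ j = 4 ^ j * 4 ^ j" by (simp flip: power_mult_distrib)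
      then show ?thesis by (simp add: n_def)
    qed
    finally show ?thesis by (simp add: n_def)
  qed
  moreover have "C * (\<Sum>k<n. w k * Si ((real n - real k) * pi)) = (\<Sum>k = 0..j.
            real ((2 * j + 1) choose k) *
            (((- 1) ^ (k + j) * Si (pi * (real j + 1 - real k)) * fact (2 * j) * (real j - real k + 1)) /
             (16 ^ j * (fact j)\<^sup>2 * (2 * real j + 1) * (2 * real j - real k + 2))))"
  proof -
    have "C * (w k * Si ((real n - real k) * pi)) = 
            real ((2 * j + 1) choose k) *
            (((- 1) ^ (k + j) * Si (pi * (real j + 1 - real k)) * fact (2 * j) * (real j - real k + 1)) /
             (16 ^ j * (fact j)\<^sup>2 * (2 * real j + 1) * (2 * real j - real k + 2)))" if "k \<le> j" for k
    proof -
      have pos: "2 * real j - real k + 2 > 0" using that by simp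
      have "(2 * n - k) * ((2 * n) choose k) = 2 * n * ((2 * j + 1) choose k)"
        using binomial_absorb_comp[of "2 * n" k] by (simp add: n_def)
      then have "real (2 * n - k) * real ((2 * n) choose k) = 2 * real n * real ((2 * j + 1) choose k)"
        by (metis of_nat_mult of_nat_numeral)
      moreover have "real (2 * n - k) = 2 * real j - real k + 2"
        using that by (simp add: n_def of_nat_diff)
      ultimately have "(2 * real j - real k + 2) * real ((2 * n) choose k) = 2 * real n * real ((2 * j + 1) choose k)"
        by simp
      then have absorb: "real ((2 * n) choose k) / (2 * real n) = real ((2 * j + 1) choose k) / (2 * real j - real k + 2)"
        using pos by (simp add: field_simps n_def)
      have central: "real ((2 * j) choose j) = fact (2 * j) / (fact j)\<^sup>2"
        by (simp add: binomial_fact power2_eq_square)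
      have factor: "real n - real k = real j - real k + 1" by (simp add: n_def)
      have argument: "(real n - real k) * pi = pi * (real j + 1 - real k)"
        by (simp add: n_def algebra_simps)
      have "C * (w k * Si ((real n - real k) * pi)) = (- 1) ^ j * real ((2 * j) choose j) / (16 ^ j * (2 * real j + 1))
        * (real ((2 * n) choose k) / (2 * real n)) * (- 1) ^ k * (real n - real k) * Si ((real n - real k) * pi)"
        by (simp add: C_def w_def mult_ac)
      then show ?thesis
        unfolding argument unfolding absorb central factor by (simp add: power_add mult_ac add_ac)
    qed
    then show ?thesis
      by (simp add: sum_distrib_left n_def lessThan_Suc_atMost atLeast0AtMost)
  qed
  ultimately show ?thesis by simp
qed

section \<open>Summation under the integral\<close>

text \<open>
  Exchange of series and integral for nonnegative terms: the partial sums are dominated by the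
  limit \<open>g\<close> itself.
\<close>
lemma has_integral_sums_nonneg:
  fixes f :: "nat \<Rightarrow> 'a::euclidean_space \<Rightarrow> real"
  assumes f: "\<And>j. (f j has_integral a j) S"
    and nonneg: "\<And>j x. x \<in> S \<Longrightarrow> 0 \<le> f j x"
    and pointwise: "\<And>x. x \<in> S \<Longrightarrow> (\<lambda>j. f j x) sums g x"
    and g: "(g has_integral I) S"
  shows "a sums I"
proof -
  let ?F = "\<lambda>N x. \<Sum>j<N. f j x"
  have F: "(?F N has_integral (\<Sum>j<N. a j)) S" for N
    by (intro has_integral_sum f) auto
  have "(\<lambda>N. integral S (?F N)) \<longlonglongrightarrow> integral S g"
  proof (rule dominated_convergence(2))
    show "?F N integrable_on S" for N using F by blast
    show "g integrable_on S" using g by blast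
    show "norm (?F N x) \<le> g x" if "x \<in> S" for N x
    proof -
      have "?F N x \<le> g x"
        using sum_le_suminf[OF sums_summable[OF pointwise[OF that]], of "{..<N}"] nonneg[OF that]
        by (simp flip: sums_unique[OF pointwise[OF that]])
      then show ?thesis using that nonneg by (simp add: sum_nonneg)
    qed
    show "(\<lambda>N. ?F N x) \<longlonglongrightarrow> g x" if "x \<in> S" for x
      using pointwise[OF that] by (simp add: sums_def)
  qed
  then show ?thesis
    using integral_unique[OF F] integral_unique[OF g] by (simp add: sums_def)
qed

text \<open>
  The pointwise sum is kept in the form \<open>u / 2 * cos (u / 2) / u\<close>, which like every term is \<open>0\<close> at
  \<open>u = 0\<close>; it differs from \<open>cos (u / 2) / 2\<close> only there. At \<open>u = pi\<close>, where the arcsine series is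
  evaluated at the boundary of its interval of convergence, the factor \<open>cos (u / 2)\<close> vanishes.
\<close>
theorem theorem1:
  shows "(\<lambda>j::nat. \<Sum>k = 0..j.
            real ((2 * j + 1) choose k) *
            (((- 1) ^ (k + j) * Si (pi * (real j + 1 - real k)) * fact (2 * j) * (real j - real k + 1)) /
             (16 ^ j * (fact j)\<^sup>2 * (2 * real j + 1) * (2 * real j - real k + 2))))
         sums (1::real)"
proof (rule has_integral_sums_nonneg[OF inner_sum_has_integral])
  fix u :: real
  assume u: "u \<in> {0..pi}"
  then have nonneg: "sin (u / 2) \<ge> 0" "cos (u / 2) \<ge> 0"
    by (auto intro!: sin_ge_zero cos_ge_zero)
  show "0 \<le> real ((2 * j) choose j) / (4 ^ j * (2 * real j + 1)) * sin (u / 2) ^ (2 * j + 1) * cos (u / 2) / u" for j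
    using nonneg u by simp
  show "(\<lambda>j. real ((2 * j) choose j) / (4 ^ j * (2 * real j + 1)) * sin (u / 2) ^ (2 * j + 1) * cos (u / 2) / u)
      sums (u / 2 * cos (u / 2) / u)"
  proof (cases "u = pi")
    case False
    then have "\<bar>u / 2\<bar> < pi / 2" using u by auto
    then have "sin (u / 2) < 1"
      using sin_monotone_2pi[of "u / 2" "pi / 2"] by simp
    then have "(\<lambda>j. real ((2 * j) choose j) / (4 ^ j * (2 * real j + 1)) * sin (u / 2) ^ (2 * j + 1))
        sums arcsin (sin (u / 2))"
      using nonneg by (intro arcsin_sums) simp
    also have "arcsin (sin (u / 2)) = u / 2"
      using u by (intro arcsin_sin) auto
    finally show ?thesis
      by (intro sums_divide sums_mult2)
  qed simp
next
  have "((\<lambda>u. cos (u / 2) / 2) has_integral (sin (pi / 2) - sin (0 / 2))) {0..pi}"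
    by (rule fundamental_theorem_of_calculus)
       (auto intro!: derivative_eq_intros simp flip: has_real_derivative_iff_has_vector_derivative)
  then have "((\<lambda>u. cos (u / 2) / 2) has_integral 1) {0..pi}" by simp
  then show "((\<lambda>u. u / 2 * cos (u / 2) / u) has_integral 1) {0..pi}"
    by (rule has_integral_spike_finite[of "{0}", rotated 2]) auto
qed

end
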